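(* Let $e\in E$ be a transmission line and $\tilde\tau\in(0,\bar\tau]$ a flow increase. Let $S^*_\alpha\in\mathcal{S}^*_\alpha(e,\tilde\tau)$ be a Correlation Index and let $S'\in2^S$ be another set of target substations. Then $S^*_\alpha\cup S'\in\mathcal{S}_\alpha(e,\tilde\tau)$.
   Context: Power grid: a finite graph $G=(V,E)$ with $n=|V|$ buses and $m=|E|$ transmission lines, and a finite set of substations $S=\{s_1,\dots,s_{n_s}\}$. Substation $s_k$ has a service area, a subgraph $G_{s_k}=(V_{s_k},E_{s_k})$ of $G$, with $\bigcup_k G_{s_k}=G$; service areas may overlap, but the overlaps contain no buses with generation. Given data: demand $P_d\in\mathbb{R}_{\ge0}^n$, generation limits $\bar P_g\in\mathbb{R}_{\ge0}^n$, line capacities $\bar P_f\in\mathbb{R}_{\ge0}^m$, a generator shift matrix $F\in\mathbb{R}^{m\times n}$ (with row $[F]_e$ for $e\in E$), cost data $c_2,c_1\in\mathbb{R}^n_{\ge0}$, $c_0\in\mathbb{R}$, $C_2=\mathrm{diag}(c_2)$, an attack bound $\bar a>0$, and $\bar\tau>0$. Security Constrained Economic Dispatch (SCED) under an attack signal $a\in\mathbb{R}^n$: minimize $\frac12P_g^\top C_2P_g+c_1^\top P_g+c_0$ over $P_g\in\mathbb{R}^n$ subject to $\mathbf 1^\top P_g=\mathbf 1^\top(P_d+a)$, $\mathbf 0\preceq P_g\preceq\bar P_g$ and $-\bar P_f\preceq F(P_g-P_d-a)\preceq\bar P_f$ (entrywise inequalities). The objective is assumed strictly convex in $P_g$. $P_g^*(a)$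 denotes the optimal solution when the problem is feasible; the problem is assumed feasible for $a=0$. The flow on line $e$ before the attack is $P_{f,e}(0)=[F]_e(P_g^*(0)-P_d)$. A coordinated cyber-attack (CCA) is identified with the set $T\in2^S$ of its target substations. Put $\delta_{s_k}=1$ if $s_k\in T$ and $\delta_{s_k}=0$ otherwise. An attack signal $a\in\mathbb{R}^n$ is admissible for $T$ if $a_i\in\delta_{s_k}[-\bar a,\bar a]$ for all $s_k\in S$ and all $i\in V_{s_k}$. The CCA $T$ is effective for the attack goal $(e,\tilde\tau)$, written $T\to(e,\tilde\tau)$, if there is an admissible $a$ for $T$ such that SCED under $a$ is feasible and $[F]_e(P_g^*(a)-P_d)\ge(1+\tilde\tau)P_{f,e}(0)$ if $P_{f,e}(0)\ge0$, respectively $[F]_e(P_g^*(a)-P_d)\le(1+\tilde\tau)P_{f,e}(0)$ if $P_{f,e}(0)<0$. The set of effective CCAs is $\mathcal{S}_\alpha(e,\tilde\tau)=\{T\in2^S: T\to(e,\tilde\tau)\}$. The security index $\kappa^*$ for $(e,\tilde\tau)$ is the least number of target substations of an effective CCA, $\kappa^*=\min\{|T|:T\in\mathcal{S}_\alpha(e,\tilde\tau)\}$. A Correlation Index (CI) for $(e,\tilde\tau)$ is an effective CCA with exactly $\kappa^*$ target substations; $\mathcal{S}^*_\alpha(e,\tilde\tau)\subseteq\mathcal{S}_\alpha(e,\tilde\tau)$ is the set of all CIs. *)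

theory Defs
  imports "HOL-Analysis.Analysis"
begin

(* The buses, lines and substations are the elements of the finite types 'n, 'm and 's.
   Lines are undirected and may be parallel, so a line is an index with a two-element set of
   end points; the reference directions of the flows enter only through the matrix F. *)
record ('n, 'm, 's) grid =
  line_ends :: "'m \<Rightarrow> 'n set"
  area_buses :: "'s \<Rightarrow> 'n set"
  area_lines :: "'s \<Rightarrow> 'm set"
  demand :: "real ^ 'n"
  gen_limit :: "real ^ 'n"
  line_capacity :: "real ^ 'm"
  shift_matrix :: "real ^ 'n ^ 'm"
  cost2 :: "real ^ 'n"
  cost1 :: "real ^ 'n"
  cost0 :: real
  attack_bound :: real
  max_increase :: real

definition diag_matrix :: "real ^ 'n \<Rightarrow> real ^ 'n ^ 'n" where
  "diag_matrix d = (\<chi> i j. if i = j then d $ i else 0)"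

definition strictly_convex_on :: "'a::real_vector set \<Rightarrow> ('a \<Rightarrow> real) \<Rightarrow> bool" where
  "strictly_convex_on X f \<longleftrightarrow> convex X \<and>
     (\<forall>x\<in>X. \<forall>y\<in>X. \<forall>t. x \<noteq> y \<longrightarrow> 0 < t \<longrightarrow> t < 1 \<longrightarrow>
        f ((1 - t) *\<^sub>R x + t *\<^sub>R y) < (1 - t) * f x + t * f y)"

definition gen_cost :: "('n::finite, 'm::finite, 's) grid \<Rightarrow> real ^ 'n \<Rightarrow> real" where
  "gen_cost G p = 1 / 2 * (p \<bullet> (diag_matrix (cost2 G) *v p)) + cost1 G \<bullet> p + cost0 G"

(* The order on vectors is the entrywise one, and 1 is the all-ones vector. *)
definition sced_feasible :: "('n::finite, 'm::finite, 's) grid \<Rightarrow> real ^ 'n \<Rightarrow> (real ^ 'n) set" where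
  "sced_feasible G a = {p.
     1 \<bullet> p = 1 \<bullet> (demand G + a) \<and>
     0 \<le> p \<and> p \<le> gen_limit G \<and>
     - line_capacity G \<le> shift_matrix G *v (p - demand G - a) \<and>
     shift_matrix G *v (p - demand G - a) \<le> line_capacity G}"

(* Meaningful only if SCED is feasible under a; the minimiser then exists, by compactness of
   the feasible set, and is unique, by strict convexity of the cost. *)
definition opt_dispatch :: "('n::finite, 'm::finite, 's) grid \<Rightarrow> real ^ 'n \<Rightarrow> real ^ 'n" where
  "opt_dispatch G a = arg_min_on (gen_cost G) (sced_feasible G a)"

(* The physical flow that results from the dispatch computed under a: the attack falsifies the
   input of SCED, not the actual demand, so a does not occur outside opt_dispatch. *)
definition line_flow :: "('n::finite, 'm::finite, 's) grid \<Rightarrow> 'm \<Rightarrow> real ^ 'n \<Rightarrow> real" where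
  "line_flow G e a = row e (shift_matrix G) \<bullet> (opt_dispatch G a - demand G)"

locale power_grid =
  fixes G :: "('n::finite, 'm::finite, 's::finite) grid"
  assumes two_ends: "card (line_ends G l) = 2"
    and area_subgraph: "l \<in> area_lines G s \<Longrightarrow> line_ends G l \<subseteq> area_buses G s"
    and areas_cover_buses: "(\<Union>s. area_buses G s) = UNIV"
    and areas_cover_lines: "(\<Union>s. area_lines G s) = UNIV"
    and no_generation_in_overlap:
      "s \<noteq> t \<Longrightarrow> i \<in> area_buses G s \<inter> area_buses G t \<Longrightarrow> gen_limit G $ i = 0"
    and demand_nonneg: "0 \<le> demand G"
    and gen_limit_nonneg: "0 \<le> gen_limit G"
    and line_capacity_nonneg: "0 \<le> line_capacity G"
    and cost2_nonneg: "0 \<le> cost2 G"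
    and cost1_nonneg: "0 \<le> cost1 G"
    and attack_bound_pos: "0 < attack_bound G"
    and max_increase_pos: "0 < max_increase G"
    and cost_strictly_convex: "strictly_convex_on UNIV (gen_cost G)"
    and feasible_without_attack: "sced_feasible G 0 \<noteq> {}"

definition admissible :: "('n::finite, 'm::finite, 's::finite) grid \<Rightarrow> 's set \<Rightarrow> real ^ 'n \<Rightarrow> bool" where
  "admissible G T a \<longleftrightarrow> (\<forall>s. \<forall>i\<in>area_buses G s.
     a $ i \<in> (\<lambda>x. of_bool (s \<in> T) * x) ` {- attack_bound G..attack_bound G})"

definition effective_CCA ::
    "('n::finite, 'm::finite, 's::finite) grid \<Rightarrow> 's set \<Rightarrow> 'm \<Rightarrow> real \<Rightarrow> bool" where
  "effective_CCA G T e \<tau> \<longleftrightarrow> (\<exists>a. admissible G T a \<and> sced_feasible G a \<noteq> {} \<and>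
     (if line_flow G e 0 \<ge> 0
      then line_flow G e a \<ge> (1 + \<tau>) * line_flow G e 0
      else line_flow G e a \<le> (1 + \<tau>) * line_flow G e 0))"

definition effective_CCAs ::
    "('n::finite, 'm::finite, 's::finite) grid \<Rightarrow> 'm \<Rightarrow> real \<Rightarrow> 's set set" where
  "effective_CCAs G e \<tau> = {T. effective_CCA G T e \<tau>}"

(* Unspecified if there is no effective CCA; there are no correlation indices then. *)
definition security_index :: "('n::finite, 'm::finite, 's::finite) grid \<Rightarrow> 'm \<Rightarrow> real \<Rightarrow> nat" where
  "security_index G e \<tau> = Min (card ` effective_CCAs G e \<tau>)"

definition correlation_indices ::
    "('n::finite, 'm::finite, 's::finite) grid \<Rightarrow> 'm \<Rightarrow> real \<Rightarrow> 's set set" where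
  "correlation_indices G e \<tau> = {T \<in> effective_CCAs G e \<tau>. card T = security_index G e \<tau>}"

end

theory Submission
  imports Defs
begin

text \<open>Effectiveness is monotone in the target set. Adding a target relaxes the constraint on
  the buses of its area from {0} to an interval around 0, so an admissible signal stays admissible
  (\<open>admissible_mono\<close>). A correlation index is effective, and its union with any set
  contains it.\<close>

lemma admissible_mono:
  assumes "0 \<le> attack_bound G" and "T \<subseteq> U" and "admissible G T a"
  shows "admissible G U a"
  unfolding admissible_def
proof (intro allI ballI)
  fix s i assume "i \<in> area_buses G s"
  with assms(3) obtain x where x: "x \<in> {- attack_bound G..attack_bound G}"
    and a: "a $ i = of_bool (s \<in> T) * x"
    unfolding admissible_def by blast
  \<comment> \<open>The witness for \<open>U\<close> is the product, not \<open>x\<close>: if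
    \<open>s\<close> lies in \<open>U\<close> but not in \<open>T\<close>, then \<open>a $ i\<close>
    is 0 while \<open>x\<close> is arbitrary.\<close>
  have "a $ i = of_bool (s \<in> U) * (of_bool (s \<in> T) * x)"
    using a assms(2) by auto
  moreover have "of_bool (s \<in> T) * x \<in> {- attack_bound G..attack_bound G}"
    using x assms(1) by auto
  ultimately show "a $ i \<in> (\<lambda>x. of_bool (s \<in> U) * x) ` {- attack_bound G..attack_bound G}"
    by (rule image_eqI)
qed

text \<open>SCED and the resulting flows depend on the signal alone, so the signal that works for
  \<open>T\<close> also works for \<open>U\<close>.\<close>

lemma effective_CCA_mono:
  assumes "0 \<le> attack_bound G" and "T \<subseteq> U" and "effective_CCA G T e \<tau>"
  shows "effective_CCA G U e \<tau>"
  using assms(3) admissible_mono[OF assms(1,2)] unfolding effective_CCA_def by blast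

theorem lemma1:
  fixes G :: "('n::finite, 'm::finite, 's::finite) grid"
    and e :: 'm and \<tau> :: real and T T' :: "'s set"
  assumes "power_grid G"
    and "\<tau> \<in> {0<..max_increase G}"
    and "T \<in> correlation_indices G e \<tau>"
  shows "T \<union> T' \<in> effective_CCAs G e \<tau>"
proof -
  have "0 \<le> attack_bound G"
    using power_grid.attack_bound_pos[OF assms(1)] by simp
  moreover have "effective_CCA G T e \<tau>"
    using assms(3) by (simp add: correlation_indices_def effective_CCAs_def)
  ultimately show ?thesis
    using effective_CCA_mono[of G T "T \<union> T'"] by (simp add: effective_CCAs_def)
qed

end
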